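(* Let $n\ge 3$, $1\le t<n$, and let $c_1,c_2,\ldots,c_t\in[n]$ be distinct integers such that the sequence $(c_1,\ldots,c_t)$ avoids both patterns $123$ and $231$. If $(c_1,\ldots,c_t)=(n,n-1,\ldots,n-t+1)$, then $$|S_{n,(c_1,\ldots,c_t)}(123,231)|=\binom{n-t}{2}+1;$$ otherwise, $|S_{n,(c_1,\ldots,c_t)}(123,231)|\in\{0,1\}$.
   Context: $[n]=\{1,\ldots,n\}$ and $S_n$ is the set of permutations of $[n]$ written as sequences $(\tau(1),\ldots,\tau(n))$. A sequence of distinct integers $\tau=(\tau(1),\ldots,\tau(m))$ contains $\sigma\in S_k$ as a pattern if there are indices $1\le i_1<\cdots<i_k\le m$ such that for all $1\le a<b\le k$, $\tau(i_a)<\tau(i_b)$ if and only if $\sigma(a)<\sigma(b)$; otherwise $\tau$ avoids $\sigma$. $S_{n,(c_1,\ldots,c_t)}(\sigma_1,\ldots,\sigma_m)$ is the set of $\tau\in S_n$ with $(\tau(1),\ldots,\tau(t))=(c_1,\ldots,c_t)$ that avoid all of $\sigma_1,\ldots,\sigma_m$. *)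

theory Defs
  imports "HOL-Combinatorics.Multiset_Permutations"
begin

text \<open>
  Sequences are lists, so positions are counted from 0. The value of \<open>i\<close> outside
  \<open>{..<length \<sigma>}\<close> is irrelevant.
\<close>

definition contains_pattern :: "nat list \<Rightarrow> nat list \<Rightarrow> bool" where
  "contains_pattern \<tau> \<sigma> \<longleftrightarrow>
     (\<exists>i :: nat \<Rightarrow> nat.
        strict_mono_on {..<length \<sigma>} i \<and>
        (\<forall>a < length \<sigma>. i a < length \<tau>) \<and>
        (\<forall>a b. a < b \<and> b < length \<sigma> \<longrightarrow>
           (\<tau> ! i a < \<tau> ! i b \<longleftrightarrow> \<sigma> ! a < \<sigma> ! b)))"

definition avoids :: "nat list \<Rightarrow> nat list \<Rightarrow> bool" where
  "avoids \<tau> \<sigma> \<longleftrightarrow> \<not> contains_pattern \<tau> \<sigma>"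

text \<open>
  The set \<open>S\<^sub>n\<^sub>,\<^sub>c(P)\<close>, where \<open>c\<close> is the prescribed initial segment and \<open>P\<close> the set of
  forbidden patterns; \<open>permutations_of_set {1..n}\<close> is \<open>S\<^sub>n\<close> in one-line notation.
\<close>

definition avoiders_with_prefix :: "nat \<Rightarrow> nat list \<Rightarrow> nat list set \<Rightarrow> nat list set" where
  "avoiders_with_prefix n c P =
     {\<tau> \<in> permutations_of_set {1..n}. take (length c) \<tau> = c \<and> (\<forall>\<sigma>\<in>P. avoids \<tau> \<sigma>)}"

end

theory Submission
  imports Defs
begin

text \<open>
  If an avoider of \<open>123\<close> and \<open>231\<close> in \<open>S\<^sub>n\<close> starts with \<open>n\<close>, this entry takes part in no occurrence,
  so deleting it gives an arbitrary avoider in \<open>S\<^sub>n\<^sub>-\<^sub>1\<close>. If it starts with \<open>x < n\<close>, the entries below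
  \<open>x\<close> precede those above \<open>x\<close> (else \<open>231\<close>), the ones above \<open>x\<close> decrease (else \<open>123\<close> with \<open>x\<close>), and the
  ones below \<open>x\<close> decrease (else \<open>123\<close> with the later entry \<open>n\<close>): there is exactly one such avoider.
  Hence the number of avoiders grows by \<open>n\<close> from \<open>S\<^sub>n\<close> to \<open>S\<^sub>n\<^sub>+\<^sub>1\<close>, and the first deviation of the prefix
  from \<open>n, n - 1, \<dots>\<close> determines everything after it.
\<close>

section \<open>Avoidance of the two patterns as conditions on entries\<close>

lemma contains_pattern_length_3:
  "contains_pattern \<tau> [p, q, r] \<longleftrightarrow>
     (\<exists>i j k. i < j \<and> j < k \<and> k < length \<tau> \<and> (\<tau> ! i < \<tau> ! j \<longleftrightarrow> p < q) \<and>
        (\<tau> ! i < \<tau> ! k \<longleftrightarrow> p < r) \<and> (\<tau> ! j < \<tau> ! k \<longleftrightarrow> q < r))"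
  (is "?L \<longleftrightarrow> ?R")
proof
  assume ?L
  then obtain f where mono: "strict_mono_on {..<3} f" and len: "\<forall>a<3. f a < length \<tau>"
    and ord: "\<forall>a b. a < b \<and> b < 3 \<longrightarrow> (\<tau> ! f a < \<tau> ! f b \<longleftrightarrow> [p, q, r] ! a < [p, q, r] ! b)"
    by (auto simp: contains_pattern_def numeral_3_eq_3)
  have "f 0 < f 1" "f 1 < f 2" "f 2 < length \<tau>"
    using mono len by (auto simp: strict_mono_on_def)
  moreover from ord have "\<tau> ! f 0 < \<tau> ! f 1 \<longleftrightarrow> p < q" "\<tau> ! f 0 < \<tau> ! f 2 \<longleftrightarrow> p < r"
      "\<tau> ! f 1 < \<tau> ! f 2 \<longleftrightarrow> q < r"
    by (simp_all add: numeral_2_eq_2)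
  ultimately show ?R by blast
next
  assume ?R
  then obtain i j k where ijk: "i < j" "j < k" "k < length \<tau>" "\<tau> ! i < \<tau> ! j \<longleftrightarrow> p < q"
      "\<tau> ! i < \<tau> ! k \<longleftrightarrow> p < r" "\<tau> ! j < \<tau> ! k \<longleftrightarrow> q < r"
    by blast
  let ?f = "\<lambda>a. [i, j, k] ! a"
  from ijk have "strict_mono_on {..<length [p, q, r]} ?f"
    by (auto simp: strict_mono_on_def less_Suc_eq)
  moreover from ijk have "\<forall>a<length [p, q, r]. ?f a < length \<tau>"
    by (auto simp: less_Suc_eq)
  moreover from ijk have "\<forall>a b. a < b \<and> b < length [p, q, r] \<longrightarrow>
      (\<tau> ! ?f a < \<tau> ! ?f b \<longleftrightarrow> [p, q, r] ! a < [p, q, r] ! b)"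
    by (auto simp: less_Suc_eq)
  ultimately show ?L unfolding contains_pattern_def by blast
qed

definition avoids_123_231 :: "nat list \<Rightarrow> bool" where
  "avoids_123_231 xs \<longleftrightarrow> avoids xs [1, 2, 3] \<and> avoids xs [2, 3, 1]"

text \<open>After an ascent, \<open>123\<close> forbids a later entry above its top and
  \<open>231\<close> one not above its bottom. The second bound is weak because lists may have
  repeated entries here.\<close>

lemma avoids_123_231_iff:
  "avoids_123_231 xs \<longleftrightarrow>
     (\<forall>i j k. i < j \<and> j < k \<and> k < length xs \<and> xs ! i < xs ! j \<longrightarrow> xs ! i < xs ! k \<and> xs ! k \<le> xs ! j)"
  (is "_ \<longleftrightarrow> (\<forall>i j k. ?Q i j k)")
proof -
  let ?P = "\<lambda>p q r i j k. i < j \<and> j < k \<and> k < length xs \<and> (xs ! i < xs ! j \<longleftrightarrow> p < q) \<and>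
    (xs ! i < xs ! k \<longleftrightarrow> p < r) \<and> (xs ! j < xs ! k \<longleftrightarrow> q < r)"
  have "?Q i j k \<longleftrightarrow>
      \<not> ?P (1::nat) (2::nat) (3::nat) i j k \<and> \<not> ?P (2::nat) (3::nat) (1::nat) i j k" for i j k
    by (cases "xs ! i < xs ! j"; cases "xs ! i < xs ! k"; cases "xs ! j < xs ! k"; simp; linarith?)
  then show ?thesis
    unfolding avoids_123_231_def avoids_def contains_pattern_length_3
    by (simp only: not_ex all_conj_distrib)
qed

lemma avoids_123_231_Nil [simp]: "avoids_123_231 []"
  by (simp add: avoids_123_231_iff)

text \<open>An occurrence either lies inside \<open>xs\<close> or starts at \<open>x\<close>; the
  \<open>sorted_wrt\<close> condition excludes the latter.\<close>

lemma avoids_123_231_Cons: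
  "avoids_123_231 (x # xs) \<longleftrightarrow>
     avoids_123_231 xs \<and> sorted_wrt (\<lambda>a b. x < a \<longrightarrow> x < b \<and> b \<le> a) xs"
  (is "?L \<longleftrightarrow> ?R")
proof
  assume L: ?L
  have "sorted_wrt (\<lambda>a b. x < a \<longrightarrow> x < b \<and> b \<le> a) xs"
    unfolding sorted_wrt_iff_nth_less
  proof (intro allI impI)
    fix i j assume "i < j" "j < length xs" "x < xs ! i"
    with L[unfolded avoids_123_231_iff, rule_format, of 0 "Suc i" "Suc j"]
    show "x < xs ! j \<and> xs ! j \<le> xs ! i" by simp
  qed
  moreover have "avoids_123_231 xs"
    unfolding avoids_123_231_iff
  proof (intro allI impI)
    fix i j k assume "i < j \<and> j < k \<and> k < length xs \<and> xs ! i < xs ! j"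
    with L[unfolded avoids_123_231_iff, rule_format, of "Suc i" "Suc j" "Suc k"]
    show "xs ! i < xs ! k \<and> xs ! k \<le> xs ! j" by simp
  qed
  ultimately show ?R by simp
next
  assume R: ?R
  show ?L
    unfolding avoids_123_231_iff
  proof (intro allI impI)
    fix i j k assume *: "i < j \<and> j < k \<and> k < length (x # xs) \<and> (x # xs) ! i < (x # xs) ! j"
    then obtain j' k' where jk: "j = Suc j'" "k = Suc k'"
      by (metis Suc_pred gr0I less_trans not_less_zero)
    show "(x # xs) ! i < (x # xs) ! k \<and> (x # xs) ! k \<le> (x # xs) ! j"
    proof (cases i)
      case 0
      with R * jk show ?thesis by (auto simp: sorted_wrt_iff_nth_less)
    next
      case (Suc i')
      with R * jk show ?thesis by (auto simp: avoids_123_231_iff)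
    qed
  qed
qed

text \<open>An ascent must go from \<open>A\<close> to \<open>B\<close>. Any later entry is then in
  \<open>B\<close>, hence above the bottom and below the top of the ascent.\<close>

lemma avoids_123_231_append_decreasing:
  assumes "sorted_wrt (>) A" and "sorted_wrt (>) B" and "\<forall>a\<in>set A. \<forall>b\<in>set B. a < b"
  shows "avoids_123_231 (A @ B)"
  using assms
proof (induction A)
  case Nil
  then show ?case
  proof (induction B)
    case (Cons x B)
    have "sorted_wrt (\<lambda>a b. x < a \<longrightarrow> x < b \<and> b \<le> a) B"
      by (rule sorted_wrt_mono_rel[of _ "(>)"]) (use Cons.prems in auto)
    with Cons show ?case by (simp add: avoids_123_231_Cons)
  qed simp
next
  case (Cons x A)
  let ?R = "\<lambda>a b. x < a \<longrightarrow> x < b \<and> b \<le> a"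
  have "sorted_wrt ?R A"
    by (rule sorted_wrt_mono_rel[of _ "(>)"]) (use Cons.prems in auto)
  moreover have "sorted_wrt ?R B"
    by (rule sorted_wrt_mono_rel[of _ "(>)"]) (use Cons.prems in auto)
  moreover have "\<forall>a\<in>set A. \<forall>b\<in>set B. ?R a b"
    using Cons.prems by fastforce
  ultimately show ?case
    using Cons by (simp add: avoids_123_231_Cons sorted_wrt_append)
qed

section \<open>Avoiders classified by their first entry\<close>

definition avoiders :: "nat \<Rightarrow> nat list \<Rightarrow> nat list set" where
  "avoiders n c = avoiders_with_prefix n c {[1, 2, 3], [2, 3, 1]}"

lemma mem_avoiders_iff:
  "xs \<in> avoiders n c \<longleftrightarrow>
     set xs = {1..n} \<and> distinct xs \<and> take (length c) xs = c \<and> avoids_123_231 xs"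
  by (auto simp: avoiders_def avoiders_with_prefix_def permutations_of_set_def avoids_123_231_def)

lemma finite_avoiders: "finite (avoiders n c)"
  by (rule finite_subset[of _ "permutations_of_set {1..n}"])
     (auto simp: avoiders_def avoiders_with_prefix_def)

text \<open>Both patterns begin with an ascent, and a leading maximum cannot be the bottom of
  one.\<close>

lemma avoiders_Cons_max: "avoiders (Suc n) (Suc n # c) = (#) (Suc n) ` avoiders n c"
proof (intro equalityI subsetI)
  fix xs assume xs: "xs \<in> avoiders (Suc n) (Suc n # c)"
  then obtain ys where ys: "xs = Suc n # ys"
    by (cases xs) (auto simp: mem_avoiders_iff)
  with xs have ins: "insert (Suc n) (set ys) = {1..Suc n}" "Suc n \<notin> set ys" and
    *: "distinct ys" "take (length c) ys = c" "avoids_123_231 ys"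
    by (simp_all add: mem_avoiders_iff avoids_123_231_Cons)
  have "set ys = {1..Suc n} - {Suc n}"
    unfolding ins(1)[symmetric] using ins(2) by simp
  also have "\<dots> = {1..n}" by auto
  finally have "ys \<in> avoiders n c"
    unfolding mem_avoiders_iff using * by simp
  with ys show "xs \<in> (#) (Suc n) ` avoiders n c" by simp
next
  fix xs assume "xs \<in> (#) (Suc n) ` avoiders n c"
  then obtain ys where ys: "xs = Suc n # ys" "ys \<in> avoiders n c" by blast
  then have set: "set ys = {1..n}" by (simp add: mem_avoiders_iff)
  have "sorted_wrt (\<lambda>a b. Suc n < a \<longrightarrow> Suc n < b \<and> b \<le> a) ys"
    by (rule sorted_wrt_mono_rel[OF _ sorted_wrt_true]) (simp add: set)
  moreover have "set xs = {1..Suc n}"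
    using ys(1) set by auto
  ultimately show "xs \<in> avoiders (Suc n) (Suc n # c)"
    using ys set by (simp add: mem_avoiders_iff avoids_123_231_Cons)
qed

lemma card_avoiders_Cons_max: "card (avoiders (Suc n) (Suc n # c)) = card (avoiders n c)"
  by (simp add: avoiders_Cons_max card_image)

text \<open>Both tails have the same entries and increase strictly under a common injective key, so
  they coincide. The prefixes \<open>c\<close> and \<open>d\<close> may differ beyond
  \<open>x\<close>.\<close>

lemma avoids_123_231_Cons_unique:
  assumes xs: "x # xs \<in> avoiders n c" and ys: "x # ys \<in> avoiders n d" and "x \<noteq> n"
  shows "xs = ys"
proof -
  text \<open>The key that lists \<open>x - 1, \<dots>, 1, n, \<dots>, x + 1\<close> in increasing order.\<close>
  define f where "f a = (if a < x then x - a else n + x + 1 - a)" for a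
  have sorted: "sorted_wrt (<) (map f zs)" if zs: "x # zs \<in> avoiders n e" for zs e
    unfolding sorted_wrt_map unfolding sorted_wrt_iff_nth_less
  proof (intro allI impI)
    fix i j assume ij: "i < j" "j < length zs"
    let ?a = "zs ! i" and ?b = "zs ! j"
    from zs have set: "insert x (set zs) = {1..n}" and dist: "distinct zs" "x \<notin> set zs"
      and av: "avoids_123_231 zs"
      and srt: "\<And>i j. i < j \<Longrightarrow> j < length zs \<Longrightarrow> x < zs ! i \<Longrightarrow> x < zs ! j \<and> zs ! j \<le> zs ! i"
      by (auto simp: mem_avoiders_iff avoids_123_231_Cons sorted_wrt_iff_nth_less)
    have "x \<in> {1..n}" using set by blast
    with \<open>x \<noteq> n\<close> have "x < n" by simp
    have mem: "?a \<in> set zs" "?b \<in> set zs" using ij by simp_all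
    then have ab: "?a \<noteq> x" "?b \<noteq> x" "?a \<le> n" "?b \<le> n" "?a \<noteq> ?b"
      using dist set ij by (auto simp: nth_eq_iff_index_eq)
    have "?b < ?a" if "?a < x" "?b < x"
    proof (rule ccontr)
      assume "\<not> ?b < ?a"
      with ab have "?a < ?b" by simp
      \<comment> \<open>The position \<open>k\<close> of \<open>n\<close> decides: before
        \<open>j\<close>, the entries \<open>x\<close>, \<open>n\<close>, \<open>?b\<close> form
        \<open>231\<close>; after \<open>j\<close>, the entries \<open>?a\<close>,
        \<open>?b\<close>, \<open>n\<close> form \<open>123\<close>.\<close>
      have "n \<in> insert x (set zs)" using set \<open>x < n\<close> by simp
      with \<open>x < n\<close> obtain k where k: "k < length zs" "zs ! k = n"
        by (auto simp: in_set_conv_nth)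
      from that \<open>x < n\<close> k have "k \<noteq> j" by auto
      show False
      proof (cases "k < j")
        case True
        with srt[of k j] ij k \<open>x < n\<close> that show False by simp
      next
        case False
        with av[unfolded avoids_123_231_iff, rule_format, of i j k] \<open>k \<noteq> j\<close> ij k \<open>?a < ?b\<close> that \<open>x < n\<close>
        show False by simp
      qed
    qed
    moreover have "x < ?b \<and> ?b < ?a" if "x < ?a"
      using srt[OF ij that] ab by simp
    ultimately show "f ?a < f ?b"
      using ab \<open>x < n\<close> by (auto simp: f_def)
  qed
  have set: "set xs = {1..n} - {x}" "set ys = {1..n} - {x}"
    using xs ys by (auto simp: mem_avoiders_iff)
  have "map f xs = map f ys"
    by (rule strict_sorted_equal) (use sorted xs ys set in auto)
  \<comment> \<open>Values below \<open>x\<close> are reversed within \<open>{1..<x}\<close>, those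
    above \<open>x\<close> within \<open>{x<..n}\<close>.\<close>
  moreover have "inj_on f ({1..n} - {x})"
    by (auto simp: inj_on_def f_def split: if_splits)
  ultimately show ?thesis
    using set by (intro map_inj_on[of f xs ys]) auto
qed

lemma card_avoiders_Cons_le_1:
  assumes "x \<noteq> n"
  shows "card (avoiders n (x # c)) \<le> 1"
proof -
  have "p = q" if "p \<in> avoiders n (x # c)" "q \<in> avoiders n (x # c)" for p q
  proof -
    from that obtain p' q' where "p = x # p'" "q = x # q'"
      by (cases p; cases q) (auto simp: mem_avoiders_iff)
    with that assms avoids_123_231_Cons_unique show ?thesis by blast
  qed
  then show ?thesis by (simp add: card_le_Suc0_iff_eq finite_avoiders)
qed

lemma card_avoiders_singleton:
  assumes "x \<in> {1..<n}"
  shows "card (avoiders n [x]) = 1"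
proof -
  \<comment> \<open>The forced arrangement \<open>x, ..., 1, n, ..., x + 1\<close>; the first block
    includes \<open>x\<close> itself.\<close>
  let ?xs = "rev [1..<Suc x] @ rev [Suc x..<Suc n]"
  have "avoids_123_231 ?xs"
    by (rule avoids_123_231_append_decreasing) (simp_all add: sorted_wrt_rev del: upt_Suc)
  moreover have "set ?xs = {1..n}" "distinct ?xs" "take (length [x]) ?xs = [x]"
    using assms by auto
  ultimately have "?xs \<in> avoiders n [x]"
    unfolding mem_avoiders_iff by blast
  then have "card (avoiders n [x]) \<noteq> 0"
    by (auto simp: finite_avoiders)
  with card_avoiders_Cons_le_1[of x n "[]"] assms show ?thesis by simp
qed

section \<open>Counting by prefix\<close>

lemma card_avoiders_Nil: "card (avoiders n []) = (n choose 2) + 1"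
proof (induction n)
  case 0
  have "avoiders 0 [] = {[]}" by (auto simp: mem_avoiders_iff)
  then show ?case by simp
next
  case (Suc n)
  have "avoiders (Suc n) [] = (\<Union>x\<in>{1..Suc n}. avoiders (Suc n) [x])"
  proof (intro equalityI subsetI)
    fix xs assume "xs \<in> avoiders (Suc n) []"
    then show "xs \<in> (\<Union>x\<in>{1..Suc n}. avoiders (Suc n) [x])"
      by (cases xs) (auto simp: mem_avoiders_iff)
  qed (auto simp: mem_avoiders_iff)
  also have "card \<dots> = (\<Sum>x\<in>{1..Suc n}. card (avoiders (Suc n) [x]))"
    by (rule card_UN_disjoint) (auto simp: finite_avoiders mem_avoiders_iff)
  \<comment> \<open>Each non-maximal first entry contributes one avoider; the summand for
    \<open>Suc n\<close> reduces to size \<open>n\<close>.\<close>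
  also have "\<dots> = (\<Sum>x\<in>{1..n}. 1) + card (avoiders n [])"
    by (simp add: card_avoiders_singleton card_avoiders_Cons_max)
  also have "\<dots> = (Suc n choose 2) + 1"
    by (simp add: Suc.IH numeral_2_eq_2)
  finally show ?case .
qed

lemma decreasing_prefix_Suc:
  "map (\<lambda>i. Suc n - i) [0..<Suc t] = Suc n # map (\<lambda>i. n - i) [0..<t]"
  by (simp del: upt_Suc add: upt_conv_Cons map_Suc_upt[symmetric])

lemma card_avoiders_decreasing_prefix:
  "t \<le> n \<Longrightarrow> card (avoiders n (map (\<lambda>i. n - i) [0..<t])) = ((n - t) choose 2) + 1"
proof (induction t arbitrary: n)
  case 0
  then show ?case by (simp add: card_avoiders_Nil)
next
  case (Suc t)
  then obtain m where "n = Suc m" by (cases n) auto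
  with Suc show ?case by (simp del: upt_Suc add: decreasing_prefix_Suc card_avoiders_Cons_max)
qed

text \<open>A head equal to \<open>n\<close> is peeled off, and the tail still deviates from the
  decreasing prefix for \<open>n - 1\<close>. At the first deviation, uniqueness of the completion
  applies.\<close>

lemma card_avoiders_other_prefix:
  "c \<noteq> map (\<lambda>i. n - i) [0..<length c] \<Longrightarrow> card (avoiders n c) \<le> 1"
proof (induction c arbitrary: n)
  case (Cons x c)
  show ?case
  \<comment> \<open>The entries of \<open>c\<close> are unrestricted, so \<open>x = n = 0\<close>
    can occur; no list over the empty set has a nonempty prefix.\<close>
  proof (cases "x = n \<and> n \<noteq> 0")
    case True
    then obtain m where "n = Suc m" by (cases n) auto
    with True Cons show ?thesis
      by (simp del: upt_Suc add: decreasing_prefix_Suc card_avoiders_Cons_max)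
  next
    case False
    then consider "x \<noteq> n" | "n = 0" by blast
    then show ?thesis
    proof cases
      case 2
      then have "avoiders n (x # c) = {}" by (auto simp: mem_avoiders_iff)
      then show ?thesis by simp
    qed (rule card_avoiders_Cons_le_1)
  qed
qed simp

theorem theorem5p9:
  fixes n t :: nat and c :: "nat list"
  assumes "n \<ge> 3" and "1 \<le> t" and "t < n"
    and "length c = t" and "set c \<subseteq> {1..n}" and "distinct c"
    and "avoids c [1, 2, 3]" and "avoids c [2, 3, 1]"
  shows "(c = map (\<lambda>i. n - i) [0..<t] \<longrightarrow>
            card (avoiders_with_prefix n c {[1, 2, 3], [2, 3, 1]}) = ((n - t) choose 2) + 1) \<and>
         (c \<noteq> map (\<lambda>i. n - i) [0..<t] \<longrightarrow>
            card (avoiders_with_prefix n c {[1, 2, 3], [2, 3, 1]}) \<in> {0, 1})"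
proof -
  have "card (avoiders n c) \<in> {0, 1}" if "c \<noteq> map (\<lambda>i. n - i) [0..<t]"
    using card_avoiders_other_prefix[of c n] that assms(4) by (auto simp: le_Suc_eq)
  with card_avoiders_decreasing_prefix[of t n] assms(3) show ?thesis
    by (auto simp: avoiders_def)
qed

end
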